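(* Let $\alpha:I\to\mathbb{R}^3$ be a nonplanar arclength parametrized curve with curvature $\kappa_\alpha>0$, and let $V\in\mathbb{R}^3$ be a constant unit vector. Then $\alpha$ is a normal helix with axis $V$ and with $W$ orthogonal to $V$ (that is, there is a unit $F$-constant normal vector field $W$ along $\alpha$ with $\langle W(s),V\rangle=0$ for all $s\in I$) if and only if $\alpha$ lies on a cylinder $C$ with rulings parallel to $V$ and the principal normal vector field $N_\alpha$ of $\alpha$ makes a constant angle with the unit normal vector field to the cylinder (along $\alpha$).
   Context: $I$ is an open interval and all curves and functions are smooth ($C^\infty$). For an arclength parametrized curve $\alpha:I\to\mathbb{R}^3$ with $\kappa_\alpha>0$, the Frenet frame $\{T_\alpha,N_\alpha,B_\alpha\}$ satisfies $T_\alpha'=\kappa_\alpha N_\alpha$, $N_\alpha'=-\kappa_\alpha T_\alpha+\tau_\alpha B_\alpha$, $B_\alpha'=-\tau_\alpha N_\alpha$. "Nonplanar" means that $\alpha$ is not contained in a plane (the torsion is not identically zero). A vector field $W$ along $\alpha$ is called $F$-constant (with respect to the Frenet frame) if $W'=D_\alpha\times W$, where $D_\alpha=\tau_\alpha T_\alpha+\kappa_\alpha B_\alpha$; equivalently, $W=aT_\alpha+bN_\alpha+cB_\alpha$ with real constants $a,b,c$. It is normal if $W(s)\in\mathrm{span}\{N_\alpha(s),B_\alpha(s)\}$ for every $s$. A curve $\alpha$ is a helix with axis $V$ if there is a unit $F$-constant vector field $W$ along $\alpha$ forming a constant angle with the fixed direction $V$; it is a normal helix if $W$ is a normal vector field.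 A cylinder $C=C_{\beta,V}$ with rulings parallel to the unit vector $V$ is the (possibly self-intersecting) surface parametrized by $X(t,z)=\beta(t)+zV$, where $\beta$ is a unit speed curve in a plane orthogonal to $V$; its unit normal is $N(t,z)=\beta'(t)\times V$. That $\alpha$ lies on $C_{\beta,V}$ means $\alpha(s)=X(t(s),z(s))$ for smooth functions $t,z$ on $I$, and the normal to the cylinder along $\alpha$ is $N(t(s),z(s))$. *)

theory Defs
  imports "HOL-Analysis.Analysis"
begin

unbundle cross3_syntax

definition open_interval :: "real set \<Rightarrow> bool" where
  "open_interval I \<longleftrightarrow> open I \<and> is_interval I \<and> I \<noteq> {}"

text \<open>
  For open \<open>I\<close>: all iterated derivatives exist at every point of \<open>I\<close>. The totalised operator
  \<open>vector_derivative\<close> yields arbitrary values at points of non-differentiability outside \<open>I\<close>,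
  but derivatives at points of the open set \<open>I\<close> do not depend on those.
\<close>
definition smooth_on :: "real set \<Rightarrow> (real \<Rightarrow> 'a::real_normed_vector) \<Rightarrow> bool" where
  "smooth_on I f \<longleftrightarrow>
     (\<forall>n. \<forall>s\<in>I. ((\<lambda>g x. vector_derivative g (at x)) ^^ n) f differentiable (at s))"

definition unit_speed_curve :: "real set \<Rightarrow> (real \<Rightarrow> real^3) \<Rightarrow> bool" where
  "unit_speed_curve I \<alpha> \<longleftrightarrow>
     smooth_on I \<alpha> \<and> (\<forall>s\<in>I. norm (vector_derivative \<alpha> (at s)) = 1)"

definition nonplanar :: "real set \<Rightarrow> (real \<Rightarrow> real^3) \<Rightarrow> bool" where
  "nonplanar I \<alpha> \<longleftrightarrow> \<not> (\<exists>v d. v \<noteq> 0 \<and> \<alpha> ` I \<subseteq> {x. v \<bullet> x = d})"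

text \<open>The Frenet apparatus, meaningful for unit speed curves with positive curvature.\<close>

definition tangent :: "(real \<Rightarrow> real^3) \<Rightarrow> real \<Rightarrow> real^3" where
  "tangent \<alpha> s = vector_derivative \<alpha> (at s)"

definition curvature :: "(real \<Rightarrow> real^3) \<Rightarrow> real \<Rightarrow> real" where
  "curvature \<alpha> s = norm (vector_derivative (tangent \<alpha>) (at s))"

definition principal_normal :: "(real \<Rightarrow> real^3) \<Rightarrow> real \<Rightarrow> real^3" where
  "principal_normal \<alpha> s = vector_derivative (tangent \<alpha>) (at s) /\<^sub>R curvature \<alpha> s"

definition binormal :: "(real \<Rightarrow> real^3) \<Rightarrow> real \<Rightarrow> real^3" where
  "binormal \<alpha> s = tangent \<alpha> s \<times> principal_normal \<alpha> s"

text \<open>The sign convention is that of \<open>B' = - \<tau> N\<close>.\<close>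
definition torsion :: "(real \<Rightarrow> real^3) \<Rightarrow> real \<Rightarrow> real" where
  "torsion \<alpha> s = - (vector_derivative (binormal \<alpha>) (at s) \<bullet> principal_normal \<alpha> s)"

definition darboux :: "(real \<Rightarrow> real^3) \<Rightarrow> real \<Rightarrow> real^3" where
  "darboux \<alpha> s = torsion \<alpha> s *\<^sub>R tangent \<alpha> s + curvature \<alpha> s *\<^sub>R binormal \<alpha> s"

definition F_constant :: "real set \<Rightarrow> (real \<Rightarrow> real^3) \<Rightarrow> (real \<Rightarrow> real^3) \<Rightarrow> bool" where
  "F_constant I \<alpha> W \<longleftrightarrow>
     smooth_on I W \<and> (\<forall>s\<in>I. (W has_vector_derivative darboux \<alpha> s \<times> W s) (at s))"

definition normal_field :: "real set \<Rightarrow> (real \<Rightarrow> real^3) \<Rightarrow> (real \<Rightarrow> real^3) \<Rightarrow> bool" where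
  "normal_field I \<alpha> W \<longleftrightarrow> (\<forall>s\<in>I. W s \<in> span {principal_normal \<alpha> s, binormal \<alpha> s})"

definition unit_field :: "real set \<Rightarrow> (real \<Rightarrow> real^3) \<Rightarrow> bool" where
  "unit_field I W \<longleftrightarrow> (\<forall>s\<in>I. norm (W s) = 1)"

definition vec_angle :: "real^3 \<Rightarrow> real^3 \<Rightarrow> real" where
  "vec_angle x y = arccos ((x \<bullet> y) / (norm x * norm y))"

definition constant_angle :: "real set \<Rightarrow> (real \<Rightarrow> real^3) \<Rightarrow> (real \<Rightarrow> real^3) \<Rightarrow> bool" where
  "constant_angle I X Y \<longleftrightarrow> (\<exists>\<theta>. \<forall>s\<in>I. vec_angle (X s) (Y s) = \<theta>)"

text \<open>
  \<open>\<alpha>\<close> is a helix (a normal helix) with axis \<open>V\<close> if a field \<open>W\<close> with the following property exists;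
  \<open>W\<close> is kept as a parameter so that further conditions can be imposed on it.
\<close>
definition helix_field ::
  "real set \<Rightarrow> (real \<Rightarrow> real^3) \<Rightarrow> real^3 \<Rightarrow> (real \<Rightarrow> real^3) \<Rightarrow> bool" where
  "helix_field I \<alpha> V W \<longleftrightarrow>
     unit_field I W \<and> F_constant I \<alpha> W \<and> constant_angle I W (\<lambda>_. V)"

definition normal_helix_field ::
  "real set \<Rightarrow> (real \<Rightarrow> real^3) \<Rightarrow> real^3 \<Rightarrow> (real \<Rightarrow> real^3) \<Rightarrow> bool" where
  "normal_helix_field I \<alpha> V W \<longleftrightarrow> helix_field I \<alpha> V W \<and> normal_field I \<alpha> W"

text \<open>
  A cylinder with rulings parallel to the unit vector \<open>V\<close> is given by its base curve \<open>\<beta>\<close>, defined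
  on an open interval \<open>J\<close>; no injectivity of \<open>\<beta>\<close> or of the parametrization is required.
\<close>
definition cylinder_base :: "real set \<Rightarrow> (real \<Rightarrow> real^3) \<Rightarrow> real^3 \<Rightarrow> bool" where
  "cylinder_base J \<beta> V \<longleftrightarrow>
     open_interval J \<and> unit_speed_curve J \<beta> \<and> (\<exists>d. \<beta> ` J \<subseteq> {x. V \<bullet> x = d})"

definition cylinder_param :: "(real \<Rightarrow> real^3) \<Rightarrow> real^3 \<Rightarrow> real \<Rightarrow> real \<Rightarrow> real^3" where
  "cylinder_param \<beta> V t z = \<beta> t + z *\<^sub>R V"

definition cylinder_normal :: "(real \<Rightarrow> real^3) \<Rightarrow> real^3 \<Rightarrow> real \<Rightarrow> real \<Rightarrow> real^3" where
  "cylinder_normal \<beta> V t z = vector_derivative \<beta> (at t) \<times> V"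

text \<open>
  The coordinate functions \<open>t\<close>, \<open>z\<close> are part of the data: on a self-intersecting cylinder the
  normal at a point is determined only by its parameters.
\<close>
definition lies_on_cylinder ::
  "real set \<Rightarrow> (real \<Rightarrow> real^3) \<Rightarrow> real set \<Rightarrow> (real \<Rightarrow> real^3) \<Rightarrow> real^3
    \<Rightarrow> (real \<Rightarrow> real) \<Rightarrow> (real \<Rightarrow> real) \<Rightarrow> bool" where
  "lies_on_cylinder I \<alpha> J \<beta> V t z \<longleftrightarrow>
     smooth_on I t \<and> smooth_on I z \<and>
     (\<forall>s\<in>I. t s \<in> J \<and> \<alpha> s = cylinder_param \<beta> V (t s) (z s))"

end

theory Submission
  imports Defs
begin

text \<open>
  The field \<open>W\<close> of the helix and the normal of the cylinder are the same field. Wherever \<open>T\<close> is not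
  parallel to \<open>V\<close>, a unit field orthogonal to both is determined up to sign, and it is the normal
  of the cylinder swept by \<open>\<alpha>\<close> in the direction \<open>V\<close>; and for such a smooth field, being
  \<open>F\<close>-constant amounts to having a constant inner product with \<open>N\<close>.

  From the cylinder to the helix, let \<open>W\<close> be the cylinder normal along \<open>\<alpha>\<close>. It is
  orthogonal to \<open>V\<close> and \<open>T\<close>, its \<open>N\<close>-component is the cosine of the given angle, and its
  \<open>B\<close>-component has constant square, hence is constant by continuity
  (\<open>on_cylinder_imp_normal_helix\<close>).

  From the helix to the cylinder, the base curve has to be the projection \<open>\<gamma>\<close> of \<open>\<alpha>\<close> to the plane
  orthogonal to \<open>V\<close>, parametrized by arclength, and the difficulty is that \<open>\<gamma>\<close> might be singular
  where \<open>T = \<plusminus>V\<close>. There \<open>\<langle>W', V\<rangle> = 0\<close> and \<open>\<langle>W, T\<rangle> = 0\<close> force \<open>\<langle>W, N\<rangle> = 0\<close>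
  (\<open>projection_speed_nonzero\<close>). The number \<open>\<langle>W, N\<rangle>\<close> is constant along \<open>\<alpha>\<close>, so if it vanishes
  somewhere then \<open>W = \<plusminus>B\<close> everywhere; then \<open>B\<close> is orthogonal to the fixed vector \<open>V\<close>, which makes
  the torsion zero and the curve planar (\<open>normal_helix_normal_component_nonzero\<close>). Nonplanarity
  is used exactly to exclude this. So \<open>\<gamma>' = f U\<close> with \<open>U = V \<times> W\<close> a unit field and \<open>f\<close> without
  zeros. An antiderivative of \<open>f\<close> is a diffeomorphism of \<open>I\<close> onto an open interval, composing \<open>\<gamma>\<close>
  with its inverse gives the base curve, and the cylinder normal is \<open>U \<times> V = W\<close>
  (\<open>lies_on_cylinder_with_normal\<close>).
\<close>

section \<open>Smoothness by finite orders\<close>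

text \<open>
  Derivatives are existentially quantified, so the predicate only depends on the values of \<open>f\<close> on
  an open \<open>I\<close>, and closure properties follow by induction on the order: a differentiation
  rule expresses the derivative through functions known to be differentiable one order less.
\<close>
primrec times_differentiable ::
  "nat \<Rightarrow> real set \<Rightarrow> (real \<Rightarrow> 'a::real_normed_vector) \<Rightarrow> bool" where
  "times_differentiable 0 I f \<longleftrightarrow> True"
| "times_differentiable (Suc n) I f \<longleftrightarrow>
     (\<exists>f'. (\<forall>s\<in>I. (f has_vector_derivative f' s) (at s)) \<and> times_differentiable n I f')"

lemma times_differentiable_SucI:
  "\<lbrakk>\<And>s. s \<in> I \<Longrightarrow> (f has_vector_derivative f' s) (at s); times_differentiable n I f'\<rbrakk>
    \<Longrightarrow> times_differentiable (Suc n) I f"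
  by auto

lemma times_differentiable_cong:
  assumes "open I" and eq: "\<And>s. s \<in> I \<Longrightarrow> f s = g s" and f: "times_differentiable n I f"
  shows "times_differentiable n I g"
proof (cases n)
  case (Suc m)
  with f obtain f' where "\<forall>s\<in>I. (f has_vector_derivative f' s) (at s)"
    and f': "times_differentiable m I f'"
    by auto
  then have "\<forall>s\<in>I. (g has_vector_derivative f' s) (at s)"
    using has_vector_derivative_transform_within_open[OF _ \<open>open I\<close>] eq by blast
  with f' Suc show ?thesis by auto
qed simp

lemma times_differentiable_Suc_D:
  "times_differentiable (Suc n) I f \<Longrightarrow> times_differentiable n I f"
proof (induction n arbitrary: f)
  case (Suc n)
  then obtain f' where "\<forall>s\<in>I. (f has_vector_derivative f' s) (at s)"
    "times_differentiable (Suc n) I f'" by auto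
  with Suc.IH[of f'] show ?case by auto
qed simp

lemma smooth_on_vector_derivative:
  assumes "smooth_on I f" shows "smooth_on I (\<lambda>s. vector_derivative f (at s))"
  unfolding smooth_on_def
proof
  fix n
  show "\<forall>s\<in>I. ((\<lambda>g x. vector_derivative g (at x)) ^^ n) (\<lambda>s. vector_derivative f (at s))
          differentiable at s"
    using assms[unfolded smooth_on_def, rule_format, of _ "Suc n"]
    by (simp add: funpow_Suc_right del: funpow.simps)
qed

lemma smooth_on_has_vector_derivative:
  assumes "smooth_on I f" "s \<in> I"
  shows "(f has_vector_derivative vector_derivative f (at s)) (at s)"
  using assms[unfolded smooth_on_def] vector_derivative_works
  by (metis funpow_0)

lemma smooth_on_iff_times_differentiable:
  assumes "open I"
  shows "smooth_on I f \<longleftrightarrow> (\<forall>n. times_differentiable n I f)"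
proof
  assume "smooth_on I f"
  show "\<forall>n. times_differentiable n I f"
  proof
    fix n show "times_differentiable n I f" using \<open>smooth_on I f\<close>
    proof (induction n arbitrary: f)
      case (Suc n)
      then have "times_differentiable n I (\<lambda>s. vector_derivative f (at s))"
        by (simp add: smooth_on_vector_derivative)
      then show ?case
        by (rule times_differentiable_SucI[rotated]) (rule smooth_on_has_vector_derivative[OF Suc.prems])
    qed simp
  qed
next
  have "\<forall>s\<in>I. ((\<lambda>g x. vector_derivative g (at x)) ^^ n) f differentiable at s"
    if "times_differentiable (Suc n) I f" for n and f :: "real \<Rightarrow> 'a"
    using that
  proof (induction n arbitrary: f)
    case 0
    then show ?case by (auto simp: differentiableI_vector)
  next
    case (Suc n)
    then obtain f' where f': "\<forall>s\<in>I. (f has_vector_derivative f' s) (at s)"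
      "times_differentiable (Suc n) I f'" by auto
    then have "times_differentiable (Suc n) I (\<lambda>s. vector_derivative f (at s))"
      using times_differentiable_cong[OF \<open>open I\<close>, of f'] vector_derivative_at by (metis (no_types, lifting))
    from Suc.IH[OF this] show ?case by (simp add: funpow_Suc_right del: funpow.simps)
  qed
  moreover assume "\<forall>n. times_differentiable n I f"
  ultimately show "smooth_on I f" unfolding smooth_on_def by blast
qed

lemma times_differentiable_add:
  "\<lbrakk>times_differentiable n I f; times_differentiable n I g\<rbrakk>
     \<Longrightarrow> times_differentiable n I (\<lambda>s. f s + g s)"
proof (induction n arbitrary: f g)
  case (Suc n)
  then obtain f' g' where "\<forall>s\<in>I. (f has_vector_derivative f' s) (at s)"
    "\<forall>s\<in>I. (g has_vector_derivative g' s) (at s)"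
    "times_differentiable n I f'" "times_differentiable n I g'" by auto
  with Suc.IH[of f' g'] show ?case
    by (intro times_differentiable_SucI[where f' = "\<lambda>s. f' s + g' s"])
      (auto intro: has_vector_derivative_add)
qed simp

lemma times_differentiable_bilinear:
  assumes bil: "bounded_bilinear mul"
  shows "\<lbrakk>times_differentiable n I f; times_differentiable n I g\<rbrakk>
    \<Longrightarrow> times_differentiable n I (\<lambda>s. mul (f s) (g s))"
proof (induction n arbitrary: f g)
  case (Suc n)
  then obtain f' g' where fg: "\<forall>s\<in>I. (f has_vector_derivative f' s) (at s)"
    "\<forall>s\<in>I. (g has_vector_derivative g' s) (at s)"
    "times_differentiable n I f'" "times_differentiable n I g'" by auto
  have "times_differentiable n I (\<lambda>s. mul (f s) (g' s) + mul (f' s) (g s))"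
    using Suc.prems[THEN times_differentiable_Suc_D] fg(3,4)
    by (intro times_differentiable_add Suc.IH)
  moreover have "((\<lambda>s. mul (f s) (g s)) has_vector_derivative
      mul (f s) (g' s) + mul (f' s) (g s)) (at s)" if "s \<in> I" for s
    using fg(1,2) that by (intro bounded_bilinear.has_vector_derivative[OF bil]) simp_all
  ultimately show ?case by (rule times_differentiable_SucI[rotated])
qed simp

lemma times_differentiable_compose:
  fixes t :: "real \<Rightarrow> real"
  assumes maps: "\<And>s. s \<in> I \<Longrightarrow> t s \<in> J"
  shows "\<lbrakk>times_differentiable n I t; times_differentiable n J g\<rbrakk>
    \<Longrightarrow> times_differentiable n I (\<lambda>s. g (t s))"
proof (induction n arbitrary: g)
  case (Suc n)
  then obtain t' g' where tg: "\<forall>s\<in>I. (t has_vector_derivative t' s) (at s)"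
    "\<forall>s\<in>J. (g has_vector_derivative g' s) (at s)"
    "times_differentiable n I t'" "times_differentiable n J g'" by auto
  have "times_differentiable n I (\<lambda>s. t' s *\<^sub>R g' (t s))"
    using Suc.prems(1)[THEN times_differentiable_Suc_D] tg(3,4)
    by (intro times_differentiable_bilinear[OF bounded_bilinear_scaleR] Suc.IH)
  moreover have "((\<lambda>s. g (t s)) has_vector_derivative t' s *\<^sub>R g' (t s)) (at s)" if "s \<in> I" for s
    using vector_diff_chain_at[OF tg(1)[rule_format, OF that] tg(2)[rule_format, OF maps[OF that]]]
    by (simp add: o_def)
  ultimately show ?case by (rule times_differentiable_SucI[rotated])
qed simp

lemma times_differentiable_const: "times_differentiable n I (\<lambda>_. c)"
proof (induction n arbitrary: c)
  case (Suc n)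
  from Suc[of 0] show ?case by (intro times_differentiable_SucI[where f' = "\<lambda>_. 0"]) simp_all
qed simp

text \<open>
  The derivative \<open>- \<langle>v, v'\<rangle> k\<^sup>3\<close> of \<open>k = 1 / |v|\<close> is a polynomial in \<open>k\<close>, \<open>v\<close> and \<open>v'\<close>, so that
  each order of differentiability of \<open>k\<close> is inherited from the order below. The scalar case
  also yields reciprocals.
\<close>
lemma times_differentiable_inverse_norm:
  fixes v :: "real \<Rightarrow> 'a::real_inner"
  assumes nz: "\<And>s. s \<in> I \<Longrightarrow> v s \<noteq> 0"
  shows "times_differentiable n I v \<Longrightarrow> times_differentiable n I (\<lambda>s. inverse (norm (v s)))"
proof (induction n)
  case (Suc n)
  then obtain v' where v': "\<forall>s\<in>I. (v has_vector_derivative v' s) (at s)"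
    "times_differentiable n I v'" by auto
  have v: "times_differentiable n I v"
    using Suc.prems by (rule times_differentiable_Suc_D)
  note mult = times_differentiable_bilinear[OF bounded_bilinear_mult]
  let ?k = "\<lambda>s. inverse (norm (v s))"
  have k: "times_differentiable n I ?k"
    using v by (rule Suc.IH)
  have "times_differentiable n I (\<lambda>s. (- 1) * ((v s \<bullet> v' s) * (?k s * (?k s * ?k s))))"
    by (intro mult k times_differentiable_bilinear[OF bounded_bilinear_inner] v v'(2)
          times_differentiable_const)
  moreover have "(?k has_vector_derivative (- 1) * ((v s \<bullet> v' s) * (?k s * (?k s * ?k s)))) (at s)"
    if "s \<in> I" for s
  proof -
    have "(v has_derivative (\<lambda>h. h *\<^sub>R v' s)) (at s)"
      using v' that by (simp add: has_vector_derivative_def)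
    then have "((\<lambda>x. norm (v x)) has_derivative (\<lambda>h. (h *\<^sub>R v' s) \<bullet> sgn (v s))) (at s)"
      by (rule has_derivative_compose[OF _ has_derivative_norm]) (rule nz[OF that])
    moreover have "(\<lambda>h. (h *\<^sub>R v' s) \<bullet> sgn (v s)) = (*) ((v s \<bullet> v' s) * ?k s)"
      by (simp add: fun_eq_iff sgn_div_norm inner_commute[of "v' s"] divide_inverse)
    ultimately have "((\<lambda>x. norm (v x)) has_real_derivative (v s \<bullet> v' s) * ?k s) (at s)"
      by (simp add: has_field_derivative_def)
    from DERIV_inverse_fun[OF this] nz[OF that] show ?thesis
      by (simp add: has_real_derivative_iff_has_vector_derivative mult_ac)
  qed
  ultimately show ?case by (rule times_differentiable_SucI[rotated])
qed simp

text \<open>The derivative of the inverse is \<open>1 / f'\<close> composed with the inverse, one order lower.\<close>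
lemma times_differentiable_inverse_function:
  fixes f :: "real \<Rightarrow> real"
  assumes "open I" "open (f ` I)"
    and f: "\<And>s. s \<in> I \<Longrightarrow> (f has_vector_derivative f' s) (at s)"
    and nz: "\<And>s. s \<in> I \<Longrightarrow> f' s \<noteq> 0"
    and inv: "\<And>s. s \<in> I \<Longrightarrow> r (f s) = s"
  shows "times_differentiable n I f' \<Longrightarrow> times_differentiable n (f ` I) r"
proof (induction n)
  case (Suc n)
  have f': "times_differentiable n I f'"
    using Suc.prems by (rule times_differentiable_Suc_D)
  have "times_differentiable n I (\<lambda>s. f' s * (inverse (norm (f' s)) * inverse (norm (f' s))))"
    by (intro times_differentiable_bilinear[OF bounded_bilinear_mult]
        times_differentiable_inverse_norm f' nz)
  moreover have "a * (inverse (norm a) * inverse (norm a)) = inverse a" for a :: real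
    by (cases a "0::real" rule: linorder_cases) simp_all
  ultimately have "times_differentiable n I (\<lambda>s. inverse (f' s))"
    by simp
  then have "times_differentiable n (f ` I) (\<lambda>x. inverse (f' (r x)))"
    using inv Suc.IH[OF f']
    by (intro times_differentiable_compose[of "f ` I" r I n "\<lambda>s. inverse (f' s)"]) auto
  moreover have "(r has_vector_derivative inverse (f' (r x))) (at x)" if x: "x \<in> f ` I" for x
  proof -
    obtain s where s: "s \<in> I" "x = f s" using x by (elim imageE)
    have "(r has_derivative (\<lambda>h. h * inverse (f' s))) (at (f s))"
    proof (rule has_derivative_inverse_on[OF \<open>open I\<close>, where f' = "\<lambda>s h. h * f' s"
          and g' = "\<lambda>s h. h * inverse (f' s)"])
      show "(f has_derivative (\<lambda>h. h * f' y)) (at y)" if "y \<in> I" for y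
        using f[OF that] by (simp add: has_vector_derivative_def)
      show "(\<lambda>h. h * f' s) \<circ> (\<lambda>h. h * inverse (f' s)) = id"
        using nz[OF s(1)] by (simp add: fun_eq_iff)
    qed (use s inv in auto)
    with s show ?thesis by (simp add: has_vector_derivative_def inv)
  qed
  ultimately show ?case by (rule times_differentiable_SucI[rotated])
qed simp

lemma smooth_on_const: "open I \<Longrightarrow> smooth_on I (\<lambda>_. c)"
  by (simp add: smooth_on_iff_times_differentiable times_differentiable_const)

lemma smooth_on_add:
  "\<lbrakk>open I; smooth_on I f; smooth_on I g\<rbrakk> \<Longrightarrow> smooth_on I (\<lambda>s. f s + g s)"
  using times_differentiable_add[of _ I f g]
  by (simp add: smooth_on_iff_times_differentiable)

lemma smooth_on_bilinear:
  "\<lbrakk>bounded_bilinear mul; open I; smooth_on I f; smooth_on I g\<rbrakk>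
    \<Longrightarrow> smooth_on I (\<lambda>s. mul (f s) (g s))"
  using times_differentiable_bilinear[of mul _ I f g]
  by (simp add: smooth_on_iff_times_differentiable)

lemma bounded_bilinear_cross3: "bounded_bilinear (\<times>)"
  using bilinear_cross by (simp add: bilinear_conv_bounded_bilinear)

lemmas smooth_on_scaleR = smooth_on_bilinear[OF bounded_bilinear_scaleR]
  and smooth_on_inner = smooth_on_bilinear[OF bounded_bilinear_inner]
  and smooth_on_cross3 = smooth_on_bilinear[OF bounded_bilinear_cross3]

lemma smooth_on_compose:
  fixes t :: "real \<Rightarrow> real"
  shows "\<lbrakk>open I; open J; smooth_on I t; smooth_on J g; \<And>s. s \<in> I \<Longrightarrow> t s \<in> J\<rbrakk>
    \<Longrightarrow> smooth_on I (\<lambda>s. g (t s))"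
  using times_differentiable_compose[of I t J _ g]
  by (simp add: smooth_on_iff_times_differentiable)

lemma smooth_on_inverse_norm:
  fixes v :: "real \<Rightarrow> 'a::real_inner"
  shows "\<lbrakk>open I; smooth_on I v; \<And>s. s \<in> I \<Longrightarrow> v s \<noteq> 0\<rbrakk>
    \<Longrightarrow> smooth_on I (\<lambda>s. inverse (norm (v s)))"
  using times_differentiable_inverse_norm[of I v]
  by (simp add: smooth_on_iff_times_differentiable)

lemma smooth_on_inverse_function:
  fixes f :: "real \<Rightarrow> real"
  assumes "open I" "open (f ` I)" "\<And>s. s \<in> I \<Longrightarrow> (f has_vector_derivative f' s) (at s)"
    "\<And>s. s \<in> I \<Longrightarrow> f' s \<noteq> 0" "\<And>s. s \<in> I \<Longrightarrow> r (f s) = s" "smooth_on I f'"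
  shows "smooth_on (f ` I) r"
  using assms times_differentiable_inverse_function[of I f f' r]
  by (simp add: smooth_on_iff_times_differentiable)

lemma smooth_on_if_derivative_smooth_on:
  assumes "open I" "\<And>s. s \<in> I \<Longrightarrow> (f has_vector_derivative f' s) (at s)" "smooth_on I f'"
  shows "smooth_on I f"
proof -
  have "times_differentiable n I f'" for n
    using assms(1,3) by (simp add: smooth_on_iff_times_differentiable)
  from times_differentiable_SucI[OF assms(2) this]
  have "times_differentiable n I f" for n
    by (rule times_differentiable_Suc_D)
  with \<open>open I\<close> show ?thesis by (simp add: smooth_on_iff_times_differentiable)
qed

lemma smooth_on_imp_continuous_on: "smooth_on I f \<Longrightarrow> continuous_on I f"
  by (intro continuous_at_imp_continuous_on ballI)
    (blast intro: has_vector_derivative_continuous smooth_on_has_vector_derivative)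


section \<open>Functions on an open interval\<close>

lemma open_interval_D:
  assumes "open_interval I" shows "open I" "convex I" "connected I" "I \<noteq> {}"
  using assms by (auto simp: open_interval_def is_interval_connected_1[symmetric] is_interval_convex)

lemma zero_derivative_imp_constant:
  assumes "open_interval I" "\<And>s. s \<in> I \<Longrightarrow> (f has_vector_derivative 0) (at s)"
  obtains c where "\<And>s. s \<in> I \<Longrightarrow> f s = c"
  using has_vector_derivative_zero_constant[of I f] open_interval_D[OF assms(1)] assms(2)
    has_vector_derivative_at_within by metis

lemma has_vector_derivative_inner:
  assumes "(f has_vector_derivative f') (at s)" "(g has_vector_derivative g') (at s)"
  shows "((\<lambda>s. f s \<bullet> g s) has_vector_derivative f s \<bullet> g' + f' \<bullet> g s) (at s)"
  by (rule bounded_bilinear.has_vector_derivative[OF bounded_bilinear_inner assms])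

lemma derivative_of_constant_inner:
  assumes "open I" "s \<in> I" "\<And>x. x \<in> I \<Longrightarrow> f x \<bullet> g x = c"
    "(f has_vector_derivative f') (at s)" "(g has_vector_derivative g') (at s)"
  shows "f s \<bullet> g' + f' \<bullet> g s = 0"
proof -
  have "((\<lambda>_. c) has_vector_derivative f s \<bullet> g' + f' \<bullet> g s) (at s)"
    using has_vector_derivative_inner[OF assms(4,5)] assms(1-3)
    by (rule has_vector_derivative_transform_within_open)
  then show ?thesis
    using vector_derivative_unique_at[OF _ has_vector_derivative_const] by blast
qed

lemma continuous_square_constant_imp_constant:
  fixes f :: "real \<Rightarrow> real"
  assumes "connected I" "continuous_on I f" "\<And>s. s \<in> I \<Longrightarrow> (f s)\<^sup>2 = a"
  shows "\<exists>c. \<forall>s\<in>I. f s = c"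
proof -
  have "f s \<in> {- sqrt a, sqrt a}" if "s \<in> I" for s
  proof -
    have "\<bar>f s\<bar> = sqrt a"
      unfolding assms(3)[OF that, symmetric] by simp
    then have "f s = sqrt a \<or> f s = - sqrt a" by linarith
    then show ?thesis by auto
  qed
  then have "f ` I \<subseteq> {- sqrt a, sqrt a}" by blast
  then have "finite (f ` I)"
    by (rule finite_subset) simp
  from continuous_finite_range_constant[OF assms(1,2) this] show ?thesis
    unfolding constant_on_def .
qed

lemma open_interval_antiderivative:
  fixes f :: "real \<Rightarrow> real"
  assumes I: "open_interval I" and f: "continuous_on I f"
  obtains F where "\<And>s. s \<in> I \<Longrightarrow> (F has_vector_derivative f s) (at s)"
proof -
  obtain c where c: "c \<in> I" using open_interval_D[OF I] by auto
  have "((\<lambda>u. LBINT y=c..u. f y) has_vector_derivative f s) (at s)" if s: "s \<in> I" for s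
  proof -
    have "\<exists>e>0. {x-e..x+e} \<subseteq> I" if "x \<in> I" for x
      using open_interval_D(1)[OF I] that open_contains_cball[of I] by (simp add: cball_eq_atLeastAtMost)
    then obtain d e where de: "d > 0" "{c-d..c+d} \<subseteq> I" "e > 0" "{s-e..s+e} \<subseteq> I"
      using c s by meson
    define a b where "a = min (c - d) (s - e)" and "b = max (c + d) (s + e)"
    have "c - d \<in> I" "s - e \<in> I" "c + d \<in> I" "s + e \<in> I"
      using de by auto
    then have "a \<in> I" "b \<in> I" unfolding a_def b_def min_def max_def by auto
    then have "{a..b} \<subseteq> I"
      using I unfolding open_interval_def is_interval_1 by (meson atLeastAtMost_iff subsetI)
    then have f_ab: "continuous_on {a..b} f" by (rule continuous_on_subset[OF f])
    have ab: "a \<le> c" "c \<le> b" "a < s" "s < b"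
      using de(1,3) by (auto simp: a_def b_def)
    then have "((\<lambda>u. LBINT y=c..u. f y) has_vector_derivative f s) (at s within {a..b})"
      using interval_integral_FTC2[OF ab(1,2) f_ab, of s] by simp
    moreover have "at s within {a..b} = at s"
      using ab(3,4) by (intro at_within_interior) simp
    ultimately show ?thesis by simp
  qed
  then show ?thesis by (rule that)
qed

text \<open>
  Injectivity is Rolle's theorem; openness of the image then needs only continuity, by invariance
  of domain.
\<close>
lemma nonzero_derivative_imp_open_interval_image:
  fixes f :: "real \<Rightarrow> real"
  assumes I: "open_interval I" and f: "\<And>s. s \<in> I \<Longrightarrow> (f has_vector_derivative f' s) (at s)"
    and nz: "\<And>s. s \<in> I \<Longrightarrow> f' s \<noteq> 0"
  shows "inj_on f I" "open_interval (f ` I)"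
proof -
  have cont: "continuous_on I f"
    using f by (meson continuous_at_imp_continuous_on has_vector_derivative_continuous)
  have "f x \<noteq> f y" if "x \<in> I" "y \<in> I" "x < y" for x y
  proof
    assume "f x = f y"
    have sub: "{x..y} \<subseteq> I"
      using I that unfolding open_interval_def is_interval_1 by (meson atLeastAtMost_iff subsetI)
    have "(f has_derivative (*) (f' z)) (at z)" if "x < z" "z < y" for z
      using f[of z] sub that
      by (simp add: subset_iff has_field_derivative_def[symmetric]
          has_real_derivative_iff_has_vector_derivative)
    from Rolle_deriv[OF \<open>x < y\<close> \<open>f x = f y\<close> continuous_on_subset[OF cont sub] this]
    obtain z where z: "x < z" "z < y" "(*) (f' z) = (\<lambda>_. 0)" by blast
    from fun_cong[OF z(3), of 1] have "f' z = 0" by simp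
    with nz[of z] sub z(1,2) show False by (simp add: subset_iff)
  qed
  then show inj: "inj_on f I"
    by (intro linorder_inj_onI') (auto simp: eq_commute)
  show "open_interval (f ` I)"
    unfolding open_interval_def is_interval_connected_1
    using invariance_of_domain[OF cont open_interval_D(1)[OF I] inj]
      connected_continuous_image[OF cont open_interval_D(3)[OF I]] open_interval_D(4)[OF I]
    by simp
qed


section \<open>The Frenet frame\<close>

lemma orthonormal_frame_expansion:
  fixes x T N :: "real^3"
  assumes "norm T = 1" "norm N = 1" "T \<bullet> N = 0"
  shows "x = (x \<bullet> T) *\<^sub>R T + (x \<bullet> N) *\<^sub>R N + (x \<bullet> (T \<times> N)) *\<^sub>R (T \<times> N)" (is "_ = ?e")
proof -
  let ?B = "T \<times> N"
  have unit: "T \<bullet> T = 1" "N \<bullet> N = 1" "N \<bullet> T = 0" "?B \<bullet> ?B = 1" "?B \<bullet> T = 0" "?B \<bullet> N = 0"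
    "T \<bullet> ?B = 0" "N \<bullet> ?B = 0"
    using assms by (simp_all add: norm_eq_1 inner_commute dot_cross dot_cross_self)
  then have B: "?B \<noteq> 0" by auto
  have "(x - ?e) \<bullet> T = 0" "(x - ?e) \<bullet> N = 0" "(x - ?e) \<bullet> ?B = 0"
    by (simp_all add: inner_diff_left inner_add_left unit assms(3))
  then have "(x - ?e) \<bullet> ?B = 0 \<and> (x - ?e) \<times> ?B = 0"
    by (simp add: Lagrange)
  with B have "x - ?e = 0" unfolding norm_and_cross_eq_0 by simp
  then show ?thesis by simp
qed

locale frenet_curve =
  fixes I :: "real set" and \<alpha> :: "real \<Rightarrow> real^3"
  assumes interval: "open_interval I"
    and unit_speed: "unit_speed_curve I \<alpha>"
    and curvature_pos: "\<And>s. s \<in> I \<Longrightarrow> curvature \<alpha> s > 0"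
begin

abbreviation "T \<equiv> tangent \<alpha>"
abbreviation "N \<equiv> principal_normal \<alpha>"
abbreviation "B \<equiv> binormal \<alpha>"
abbreviation "\<kappa> \<equiv> curvature \<alpha>"
abbreviation "\<tau> \<equiv> torsion \<alpha>"
abbreviation "D \<equiv> darboux \<alpha>"

lemmas open_I = open_interval_D(1)[OF interval]

lemma smooth_curve: "smooth_on I \<alpha>"
  using unit_speed by (simp add: unit_speed_curve_def)

lemma curve_derivative: "s \<in> I \<Longrightarrow> (\<alpha> has_vector_derivative T s) (at s)"
  using smooth_on_has_vector_derivative[OF smooth_curve] by (simp add: tangent_def)

lemma smooth_tangent: "smooth_on I T"
  using smooth_on_vector_derivative[OF smooth_curve] by (simp add: tangent_def[abs_def])

lemma tangent_derivative: "s \<in> I \<Longrightarrow> (T has_vector_derivative \<kappa> s *\<^sub>R N s) (at s)"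
  using smooth_on_has_vector_derivative[OF smooth_tangent] curvature_pos[of s]
  by (simp add: principal_normal_def)

lemma smooth_principal_normal: "smooth_on I N"
proof -
  let ?T' = "\<lambda>s. vector_derivative T (at s)"
  have T': "smooth_on I ?T'"
    by (rule smooth_on_vector_derivative[OF smooth_tangent])
  have "?T' s \<noteq> 0" if "s \<in> I" for s
    using curvature_pos[OF that] by (auto simp: curvature_def)
  from smooth_on_scaleR[OF open_I smooth_on_inverse_norm[OF open_I T' this] T']
  show ?thesis
    by (simp add: principal_normal_def[abs_def] curvature_def[abs_def])
qed

lemma smooth_binormal: "smooth_on I B"
  using smooth_on_cross3[OF open_I smooth_tangent smooth_principal_normal]
  by (simp add: binormal_def[abs_def])

lemma frame:
  assumes "s \<in> I"
  shows "T s \<bullet> T s = 1" "N s \<bullet> N s = 1" "B s \<bullet> B s = 1"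
    "T s \<bullet> N s = 0" "T s \<bullet> B s = 0" "N s \<bullet> B s = 0"
    "N s \<bullet> T s = 0" "B s \<bullet> T s = 0" "B s \<bullet> N s = 0"
proof -
  have T: "T x \<bullet> T x = 1" if "x \<in> I" for x
    using unit_speed that by (simp add: unit_speed_curve_def tangent_def norm_eq_1)
  have "norm (N s) = 1"
    using curvature_pos[OF assms] by (simp add: principal_normal_def flip: curvature_def)
  then have N: "N s \<bullet> N s = 1" by (simp add: norm_eq_1)
  have "T s \<bullet> (\<kappa> s *\<^sub>R N s) + (\<kappa> s *\<^sub>R N s) \<bullet> T s = 0"
    using open_I assms T tangent_derivative[OF assms] tangent_derivative[OF assms]
    by (rule derivative_of_constant_inner)
  then have TN: "T s \<bullet> N s = 0"
    using curvature_pos[OF assms] by (simp add: inner_commute)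
  show "T s \<bullet> T s = 1" "N s \<bullet> N s = 1" "B s \<bullet> B s = 1"
    "T s \<bullet> N s = 0" "T s \<bullet> B s = 0" "N s \<bullet> B s = 0"
    "N s \<bullet> T s = 0" "B s \<bullet> T s = 0" "B s \<bullet> N s = 0"
    using T[OF assms] N TN by (simp_all add: binormal_def dot_cross dot_cross_self inner_commute)
qed

lemma frame_cross:
  assumes "s \<in> I"
  shows "T s \<times> N s = B s" "N s \<times> B s = T s" "B s \<times> T s = N s"
    "N s \<times> T s = - B s" "B s \<times> N s = - T s" "T s \<times> B s = - N s"
proof -
  show B: "T s \<times> N s = B s" by (simp add: binormal_def)
  show NB: "N s \<times> B s = T s" and TB: "T s \<times> B s = - N s"
    unfolding binormal_def Lagrange by (simp_all add: frame[OF assms])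
  show "B s \<times> T s = N s" "N s \<times> T s = - B s" "B s \<times> N s = - T s"
    using B NB TB cross_skew[of "B s" "T s"] cross_skew[of "N s" "T s"] cross_skew[of "B s" "N s"]
    by simp_all
qed

lemma frame_expansion:
  assumes "s \<in> I"
  shows "x = (x \<bullet> T s) *\<^sub>R T s + (x \<bullet> N s) *\<^sub>R N s + (x \<bullet> B s) *\<^sub>R B s"
  using orthonormal_frame_expansion[of "T s" "N s" x]
  by (simp add: frame[OF assms] norm_eq_1 binormal_def)

text \<open>
  Differentiating \<open>B = T \<times> N\<close> leaves \<open>B' = T \<times> N'\<close>, which is orthogonal to \<open>T\<close>, and also to \<open>B\<close>
  since \<open>B\<close> has constant length; so only the \<open>N\<close>-component, which defines the torsion, survives.
\<close>
lemma binormal_derivative: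
  assumes s: "s \<in> I" shows "(B has_vector_derivative - \<tau> s *\<^sub>R N s) (at s)"
proof -
  define B' where "B' = vector_derivative B (at s)"
  have B': "(B has_vector_derivative B') (at s)"
    unfolding B'_def by (rule smooth_on_has_vector_derivative[OF smooth_binormal s])
  obtain N' where N': "(N has_vector_derivative N') (at s)"
    using smooth_on_has_vector_derivative[OF smooth_principal_normal s] by blast
  have "(B has_vector_derivative T s \<times> N' + (\<kappa> s *\<^sub>R N s) \<times> N s) (at s)"
    using bounded_bilinear.has_vector_derivative[OF bounded_bilinear_cross3 tangent_derivative[OF s] N']
    by (simp add: binormal_def[abs_def])
  with B' have "B' = T s \<times> N'"
    by (metis add.right_neutral cross_mult_left cross_refl scaleR_zero_right vector_derivative_unique_at)
  then have "B' \<bullet> T s = 0"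
    by (simp add: dot_cross_self inner_commute)
  moreover have "B s \<bullet> B' + B' \<bullet> B s = 0"
    using open_I s frame(3) B' B' by (rule derivative_of_constant_inner)
  then have "B' \<bullet> B s = 0" by (simp add: inner_commute)
  ultimately have "B' = (B' \<bullet> N s) *\<^sub>R N s"
    using frame_expansion[OF s, of B'] by simp
  then have "B' = - \<tau> s *\<^sub>R N s"
    by (simp add: torsion_def B'_def)
  with B' show ?thesis by simp
qed

lemma normal_derivative:
  assumes s: "s \<in> I" shows "(N has_vector_derivative - \<kappa> s *\<^sub>R T s + \<tau> s *\<^sub>R B s) (at s)"
proof -
  have "((\<lambda>x. B x \<times> T x) has_vector_derivative
      B s \<times> (\<kappa> s *\<^sub>R N s) + (- \<tau> s *\<^sub>R N s) \<times> T s) (at s)"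
    by (rule bounded_bilinear.has_vector_derivative[OF bounded_bilinear_cross3
          binormal_derivative[OF s] tangent_derivative[OF s]])
  then have "(N has_vector_derivative B s \<times> (\<kappa> s *\<^sub>R N s) + (- \<tau> s *\<^sub>R N s) \<times> T s) (at s)"
    using open_I s frame_cross(3) by (rule has_vector_derivative_transform_within_open)
  then show ?thesis
    by (simp add: cross_mult_left cross_mult_right frame_cross[OF s])
qed

lemma darboux_cross:
  assumes s: "s \<in> I"
  shows "D s \<times> N s = - \<kappa> s *\<^sub>R T s + \<tau> s *\<^sub>R B s" "D s \<times> B s = - \<tau> s *\<^sub>R N s"
  by (simp_all add: darboux_def cross_add_left cross_mult_left frame_cross[OF s])

lemma F_constant_combination: "F_constant I \<alpha> (\<lambda>s. b *\<^sub>R N s + c *\<^sub>R B s)"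
  unfolding F_constant_def
proof
  show "smooth_on I (\<lambda>s. b *\<^sub>R N s + c *\<^sub>R B s)"
    by (intro smooth_on_add smooth_on_scaleR smooth_on_const open_I
        smooth_principal_normal smooth_binormal)
  show "\<forall>s\<in>I. ((\<lambda>s. b *\<^sub>R N s + c *\<^sub>R B s) has_vector_derivative
      D s \<times> (b *\<^sub>R N s + c *\<^sub>R B s)) (at s)"
  proof
    fix s assume s: "s \<in> I"
    have "((\<lambda>s. b *\<^sub>R N s + c *\<^sub>R B s) has_vector_derivative
      b *\<^sub>R (D s \<times> N s) + c *\<^sub>R (D s \<times> B s)) (at s)"
      unfolding darboux_cross[OF s]
      by (intro has_vector_derivative_add
          bounded_linear.has_vector_derivative[OF bounded_linear_scaleR_right]
          normal_derivative[OF s] binormal_derivative[OF s])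
    then show "((\<lambda>s. b *\<^sub>R N s + c *\<^sub>R B s) has_vector_derivative
      D s \<times> (b *\<^sub>R N s + c *\<^sub>R B s)) (at s)"
      by (simp add: cross_add_right cross_mult_right)
  qed
qed

text \<open>
  Both \<open>W\<close> and \<open>N\<close> satisfy \<open>X' = D \<times> X\<close>; two such fields rotate rigidly together.
\<close>
lemma F_constant_inner_normal_constant:
  assumes "F_constant I \<alpha> W"
  obtains b where "\<And>s. s \<in> I \<Longrightarrow> W s \<bullet> N s = b"
proof (rule zero_derivative_imp_constant[OF interval, of "\<lambda>s. W s \<bullet> N s"])
  fix s assume s: "s \<in> I"
  have "(W has_vector_derivative D s \<times> W s) (at s)"
    using assms s by (simp add: F_constant_def)
  moreover have "(N has_vector_derivative D s \<times> N s) (at s)"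
    using normal_derivative[OF s] by (simp add: darboux_cross[OF s])
  ultimately have "((\<lambda>s. W s \<bullet> N s) has_vector_derivative
      W s \<bullet> (D s \<times> N s) + (D s \<times> W s) \<bullet> N s) (at s)"
    by (rule has_vector_derivative_inner)
  moreover have "W s \<bullet> (D s \<times> N s) + (D s \<times> W s) \<bullet> N s = 0"
    by (simp add: cross3_simps)
  ultimately show "((\<lambda>s. W s \<bullet> N s) has_vector_derivative 0) (at s)" by simp
qed (use that in blast)

lemma torsion_zero_imp_planar:
  assumes "\<And>s. s \<in> I \<Longrightarrow> \<tau> s = 0"
  shows "\<not> nonplanar I \<alpha>"
proof -
  obtain b where b: "\<And>s. s \<in> I \<Longrightarrow> B s = b"
    using zero_derivative_imp_constant[OF interval, of B] binormal_derivative assms by force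
  have "((\<lambda>s. b \<bullet> \<alpha> s) has_vector_derivative 0) (at s)" if s: "s \<in> I" for s
    using has_vector_derivative_inner[OF has_vector_derivative_const[of b] curve_derivative[OF s]]
      frame(8)[OF s] b[OF s] by simp
  from zero_derivative_imp_constant[OF interval this]
  obtain d where d: "\<And>s. s \<in> I \<Longrightarrow> b \<bullet> \<alpha> s = d" by blast
  obtain s where "s \<in> I" using open_interval_D(4)[OF interval] by blast
  with frame(3)[of s] b[of s] have "b \<noteq> 0" by auto
  with d show ?thesis unfolding nonplanar_def by blast
qed

text \<open>
  Differentiating \<open>\<langle>B, V\<rangle> = 0\<close> gives \<open>\<tau> \<langle>N, V\<rangle> = 0\<close>. Where \<open>\<tau> \<noteq> 0\<close>, differentiating
  \<open>\<langle>N, V\<rangle> = 0\<close> gives \<open>\<kappa> \<langle>T, V\<rangle> = 0\<close>, and then \<open>V\<close> is orthogonal to the whole frame.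
\<close>
lemma binormal_orthogonal_to_direction_imp_torsion_zero:
  assumes "V \<noteq> 0" and BV: "\<And>s. s \<in> I \<Longrightarrow> B s \<bullet> V = 0" and s: "s \<in> I"
  shows "\<tau> s = 0"
proof (rule ccontr)
  assume nz: "\<tau> s \<noteq> 0"
  have const: "((\<lambda>_. V) has_vector_derivative 0) (at x)" for x by simp
  have NV: "\<tau> x * (N x \<bullet> V) = 0" if "x \<in> I" for x
    using derivative_of_constant_inner[OF open_I that BV binormal_derivative[OF that] const] by simp
  define U where "U = {x \<in> I. \<tau> x \<noteq> 0}"
  have "smooth_on I (\<lambda>x. vector_derivative B (at x) \<bullet> N x)"
    by (rule smooth_on_inner[OF open_I smooth_on_vector_derivative[OF smooth_binormal]
          smooth_principal_normal])
  then have "continuous_on I \<tau>"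
    unfolding torsion_def[abs_def]
    by (intro continuous_on_minus smooth_on_imp_continuous_on)
  from continuous_open_preimage[OF this open_I, of "- {0}"]
  have "open U" by (simp add: U_def vimage_def Int_def open_Compl)
  moreover have "s \<in> U" using nz s by (simp add: U_def)
  moreover have "N x \<bullet> V = 0" if "x \<in> U" for x
    using NV[of x] that by (simp add: U_def)
  ultimately have "N s \<bullet> 0 + (- \<kappa> s *\<^sub>R T s + \<tau> s *\<^sub>R B s) \<bullet> V = 0"
    using normal_derivative[OF s] const by (rule derivative_of_constant_inner)
  then have "T s \<bullet> V = 0"
    using curvature_pos[OF s] BV[OF s] by (simp add: inner_add_left inner_diff_left)
  moreover have "N s \<bullet> V = 0" using NV[OF s] nz by simp
  ultimately have "V = 0"
    using frame_expansion[OF s, of V] BV[OF s] by (simp add: inner_commute)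
  with \<open>V \<noteq> 0\<close> show False by simp
qed


section \<open>Normal helices and cylinders\<close>

lemma vec_angle_unit: "norm x = 1 \<Longrightarrow> norm y = 1 \<Longrightarrow> vec_angle x y = arccos (x \<bullet> y)"
  by (simp add: vec_angle_def)

lemma normal_field_orthogonal_tangent:
  assumes "normal_field I \<alpha> W" and s: "s \<in> I"
  shows "W s \<bullet> T s = 0"
proof -
  have "W s \<in> span {N s, B s}" using assms by (simp add: normal_field_def)
  then have "orthogonal (T s) (W s)"
    by (rule orthogonal_to_span) (auto simp: orthogonal_def frame[OF s])
  then show ?thesis by (simp add: orthogonal_def inner_commute)
qed

text \<open>
  Otherwise \<open>W = \<plusminus>B\<close> at every point, so \<open>B\<close> is orthogonal to \<open>V\<close> and the torsion vanishes.
\<close>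
lemma normal_helix_normal_component_nonzero:
  assumes "nonplanar I \<alpha>" "V \<noteq> 0"
    and unit: "\<And>s. s \<in> I \<Longrightarrow> norm (W s) = 1"
    and WT: "\<And>s. s \<in> I \<Longrightarrow> W s \<bullet> T s = 0"
    and WV: "\<And>s. s \<in> I \<Longrightarrow> W s \<bullet> V = 0"
  shows "\<exists>s\<in>I. W s \<bullet> N s \<noteq> 0"
proof (rule ccontr)
  assume none: "\<not> ?thesis"
  have "B s \<bullet> V = 0" if s: "s \<in> I" for s
  proof -
    have W: "W s = (W s \<bullet> B s) *\<^sub>R B s"
      using frame_expansion[OF s, of "W s"] none s WT by auto
    have "W s \<bullet> B s \<noteq> 0"
      using W unit[OF s] by auto
    moreover have "(W s \<bullet> B s) * (B s \<bullet> V) = 0"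
      using WV[OF s] by (subst (asm) W) simp
    ultimately show ?thesis by simp
  qed
  from binormal_orthogonal_to_direction_imp_torsion_zero[OF \<open>V \<noteq> 0\<close> this]
  show False using torsion_zero_imp_planar \<open>nonplanar I \<alpha>\<close> by blast
qed

text \<open>
  The vector \<open>V \<times> W\<close> is the direction of the projection of \<open>\<alpha>\<close> to the plane orthogonal to \<open>V\<close>. At
  a singular point of the projection \<open>T\<close> would be parallel to \<open>V\<close>, whence \<open>\<langle>W', T\<rangle> = 0\<close>, whereas
  differentiating \<open>\<langle>W, T\<rangle> = 0\<close> gives \<open>\<langle>W', T\<rangle> = - \<kappa> \<langle>W, N\<rangle>\<close>.
\<close>
lemma projection_speed_nonzero:
  assumes V: "norm V = 1"
    and unit: "\<And>s. s \<in> I \<Longrightarrow> norm (W s) = 1"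
    and W': "\<And>s. s \<in> I \<Longrightarrow> (W has_vector_derivative W' s) (at s)"
    and WT: "\<And>s. s \<in> I \<Longrightarrow> W s \<bullet> T s = 0"
    and WV: "\<And>s. s \<in> I \<Longrightarrow> W s \<bullet> V = 0"
    and WN: "\<And>s. s \<in> I \<Longrightarrow> W s \<bullet> N s \<noteq> 0"
    and s: "s \<in> I"
  shows "T s = (T s \<bullet> V) *\<^sub>R V + (T s \<bullet> (V \<times> W s)) *\<^sub>R (V \<times> W s)" "T s \<bullet> (V \<times> W s) \<noteq> 0"
proof -
  show T: "T s = (T s \<bullet> V) *\<^sub>R V + (T s \<bullet> (V \<times> W s)) *\<^sub>R (V \<times> W s)"
    using orthonormal_frame_expansion[OF V unit[OF s], of "T s"] WV[OF s] WT[OF s]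
    by (simp add: inner_commute)
  show "T s \<bullet> (V \<times> W s) \<noteq> 0"
  proof
    assume "T s \<bullet> (V \<times> W s) = 0"
    with T have TV: "T s = (T s \<bullet> V) *\<^sub>R V" by simp
    have "W s \<bullet> 0 + W' s \<bullet> V = 0"
      using open_I s WV W'[OF s] has_vector_derivative_const
      by (rule derivative_of_constant_inner)
    then have "W' s \<bullet> T s = 0" by (subst TV) simp
    moreover have "W s \<bullet> (\<kappa> s *\<^sub>R N s) + W' s \<bullet> T s = 0"
      using open_I s WT W'[OF s] tangent_derivative[OF s]
      by (rule derivative_of_constant_inner)
    ultimately show False
      using curvature_pos[OF s] WN[OF s] by simp
  qed
qed

text \<open>
  The base of the cylinder is the projection of \<open>\<alpha>\<close>, reparametrized by its signed arclength \<open>t\<close>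
  with respect to the direction \<open>V \<times> W\<close>; the cylinder normal \<open>(V \<times> W) \<times> V\<close> is then \<open>W\<close> itself.
\<close>
lemma lies_on_cylinder_with_normal:
  assumes V: "norm V = 1"
    and smooth_W: "smooth_on I W"
    and unit: "\<And>s. s \<in> I \<Longrightarrow> norm (W s) = 1"
    and WV: "\<And>s. s \<in> I \<Longrightarrow> W s \<bullet> V = 0"
    and T: "\<And>s. s \<in> I \<Longrightarrow> T s = (T s \<bullet> V) *\<^sub>R V + (T s \<bullet> (V \<times> W s)) *\<^sub>R (V \<times> W s)"
    and regular: "\<And>s. s \<in> I \<Longrightarrow> T s \<bullet> (V \<times> W s) \<noteq> 0"
  obtains J \<beta> t z where "cylinder_base J \<beta> V" "lies_on_cylinder I \<alpha> J \<beta> V t z"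
    "\<And>s. s \<in> I \<Longrightarrow> cylinder_normal \<beta> V (t s) (z s) = W s"
proof -
  define U where "U s = V \<times> W s" for s
  define f where "f s = T s \<bullet> U s" for s
  define \<gamma> where "\<gamma> s = \<alpha> s + (- (\<alpha> s \<bullet> V)) *\<^sub>R V" for s
  have VV: "V \<bullet> V = 1" using V by (simp add: norm_eq_1)
  have f_nz: "f s \<noteq> 0" if "s \<in> I" for s
    using regular[OF that] by (simp add: f_def U_def)
  have smooth_f: "smooth_on I f"
    unfolding f_def U_def
    by (intro smooth_on_inner smooth_on_cross3 smooth_on_const open_I smooth_tangent smooth_W)
  obtain t where t: "\<And>s. s \<in> I \<Longrightarrow> (t has_vector_derivative f s) (at s)"
    using open_interval_antiderivative[OF interval smooth_on_imp_continuous_on[OF smooth_f]] by blast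
  note t_image = nonzero_derivative_imp_open_interval_image[OF interval t f_nz]
  define J where "J = t ` I"
  define r where "r = inv_into I t"
  have r: "r (t s) = s" if "s \<in> I" for s
    using t_image(1) that by (simp add: r_def)
  have J: "open_interval J" "open J"
    using t_image(2) by (simp_all add: J_def open_interval_D)
  have smooth_t: "smooth_on I t"
    using open_I t smooth_f by (rule smooth_on_if_derivative_smooth_on)
  have smooth_r: "smooth_on J r"
    using smooth_on_inverse_function[OF open_I _ t f_nz r smooth_f] J by (simp add: J_def)
  have smooth_z: "smooth_on I (\<lambda>s. \<alpha> s \<bullet> V)"
    by (intro smooth_on_inner smooth_on_const open_I smooth_curve)
  have smooth_\<gamma>: "smooth_on I \<gamma>"
  proof -
    have "smooth_on I (\<lambda>s. \<alpha> s + (- 1) *\<^sub>R ((\<alpha> s \<bullet> V) *\<^sub>R V))"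
      by (rule smooth_on_add[OF open_I smooth_curve smooth_on_scaleR[OF open_I
              smooth_on_const[OF open_I] smooth_on_scaleR[OF open_I smooth_z
                smooth_on_const[OF open_I]]]])
    then show ?thesis by (simp add: \<gamma>_def[abs_def])
  qed
  have \<gamma>': "(\<gamma> has_vector_derivative f s *\<^sub>R U s) (at s)" if s: "s \<in> I" for s
  proof -
    have "((\<lambda>s. \<alpha> s \<bullet> V) has_vector_derivative T s \<bullet> V) (at s)"
      using has_vector_derivative_inner[OF curve_derivative[OF s] has_vector_derivative_const[of V]]
      by simp
    then have "((\<lambda>s. (\<alpha> s \<bullet> V) *\<^sub>R V) has_vector_derivative (T s \<bullet> V) *\<^sub>R V) (at s)"
      by (rule bounded_linear.has_vector_derivative[OF bounded_linear_scaleR_left])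
    from has_vector_derivative_diff[OF curve_derivative[OF s] this]
    have "(\<gamma> has_vector_derivative T s - (T s \<bullet> V) *\<^sub>R V) (at s)"
      by (simp add: \<gamma>_def[abs_def])
    moreover have "T s - (T s \<bullet> V) *\<^sub>R V = f s *\<^sub>R U s"
      using T[OF s] unfolding f_def U_def by (metis add_diff_cancel_left')
    ultimately show ?thesis by simp
  qed
  define \<beta> where "\<beta> x = \<gamma> (r x)" for x
  have r_J: "r x \<in> I" if "x \<in> J" for x
    using that r by (auto simp: J_def)
  have smooth_\<beta>: "smooth_on J \<beta>"
    unfolding \<beta>_def using J(2) open_I smooth_r smooth_\<gamma> r_J by (rule smooth_on_compose)
  have \<beta>': "vector_derivative \<beta> (at (t s)) = U s" if s: "s \<in> I" for s
  proof -
    have "t s \<in> J" using s by (simp add: J_def)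
    from vector_diff_chain_at[OF t[OF s] smooth_on_has_vector_derivative[OF smooth_\<beta> this]]
    have "(\<beta> \<circ> t has_vector_derivative f s *\<^sub>R vector_derivative \<beta> (at (t s))) (at s)" .
    then have "(\<gamma> has_vector_derivative f s *\<^sub>R vector_derivative \<beta> (at (t s))) (at s)"
      using open_I s by (rule has_vector_derivative_transform_within_open) (simp add: \<beta>_def r)
    \<comment> \<open>Both \<open>\<gamma>'\<close> and \<open>(\<beta> \<circ> t)'\<close> carry the factor \<open>t' = f\<close>, which may be cancelled.\<close>
    from vector_derivative_unique_at[OF this \<gamma>'[OF s]] show ?thesis
      using f_nz[OF s] by simp
  qed
  have "norm (U s) = 1" if "s \<in> I" for s
    using VV unit[OF that] WV[OF that]
    by (simp add: U_def norm_eq_1 dot_cross inner_commute)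
  then have "unit_speed_curve J \<beta>"
    using smooth_\<beta> by (auto simp: unit_speed_curve_def J_def \<beta>')
  moreover have "V \<bullet> \<beta> x = 0" for x
    by (simp add: \<beta>_def \<gamma>_def inner_diff_right inner_add_right VV inner_commute)
  ultimately have "cylinder_base J \<beta> V"
    using J(1) by (auto simp: cylinder_base_def)
  moreover have "lies_on_cylinder I \<alpha> J \<beta> V t (\<lambda>s. \<alpha> s \<bullet> V)"
    using smooth_t smooth_z
    by (auto simp: lies_on_cylinder_def cylinder_param_def J_def \<beta>_def \<gamma>_def r)
  moreover have "cylinder_normal \<beta> V (t s) (\<alpha> s \<bullet> V) = W s" if s: "s \<in> I" for s
  proof -
    have "(V \<times> W s) \<times> V = - (V \<times> (V \<times> W s))" by (rule cross_skew)
    then show ?thesis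
      using WV[OF s] by (simp add: cylinder_normal_def \<beta>'[OF s] U_def Lagrange VV inner_commute)
  qed
  ultimately show ?thesis by (rule that)
qed

lemma normal_helix_imp_on_cylinder:
  assumes "nonplanar I \<alpha>" and V: "norm V = 1"
    and W: "normal_helix_field I \<alpha> V W" and "\<forall>s\<in>I. W s \<bullet> V = 0"
  shows "\<exists>J \<beta> t z. cylinder_base J \<beta> V \<and> lies_on_cylinder I \<alpha> J \<beta> V t z \<and>
            constant_angle I N (\<lambda>s. cylinder_normal \<beta> V (t s) (z s))"
proof -
  have F: "F_constant I \<alpha> W"
    using W by (simp add: normal_helix_field_def helix_field_def)
  have unit: "norm (W s) = 1" and WT: "W s \<bullet> T s = 0" and WV: "W s \<bullet> V = 0" if "s \<in> I" for s
    using W that assms(4) normal_field_orthogonal_tangent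
    by (auto simp: normal_helix_field_def helix_field_def unit_field_def)
  have W': "(W has_vector_derivative D s \<times> W s) (at s)" if "s \<in> I" for s
    using F that by (simp add: F_constant_def)
  obtain b where b: "\<And>s. s \<in> I \<Longrightarrow> W s \<bullet> N s = b"
    using F_constant_inner_normal_constant[OF F] by blast
  have "V \<noteq> 0" using V by auto
  from normal_helix_normal_component_nonzero[OF assms(1) this unit WT WV] b
  have WN: "W s \<bullet> N s \<noteq> 0" if "s \<in> I" for s using that by auto
  have "smooth_on I W" using F by (simp add: F_constant_def)
  from lies_on_cylinder_with_normal[OF V this unit WV
      projection_speed_nonzero[OF V unit W' WT WV WN]]
  obtain J \<beta> t z where C: "cylinder_base J \<beta> V" "lies_on_cylinder I \<alpha> J \<beta> V t z"
    "\<And>s. s \<in> I \<Longrightarrow> cylinder_normal \<beta> V (t s) (z s) = W s" by blast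
  have "vec_angle (N s) (cylinder_normal \<beta> V (t s) (z s)) = arccos b" if s: "s \<in> I" for s
    using b[OF s] unit[OF s] frame(2)[OF s]
    by (simp add: C(3)[OF s] vec_angle_unit norm_eq_1 inner_commute)
  with C(1,2) show ?thesis unfolding constant_angle_def by blast
qed

lemma cylinder_normal_along_curve:
  assumes V: "norm V = 1"
    and base: "cylinder_base J \<beta> V" and on: "lies_on_cylinder I \<alpha> J \<beta> V t z"
  defines "M \<equiv> \<lambda>s. cylinder_normal \<beta> V (t s) (z s)"
  shows "smooth_on I M" "\<And>s. s \<in> I \<Longrightarrow> norm (M s) = 1"
    "\<And>s. s \<in> I \<Longrightarrow> M s \<bullet> V = 0" "\<And>s. s \<in> I \<Longrightarrow> M s \<bullet> T s = 0"
proof -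
  let ?\<beta>' = "\<lambda>x. vector_derivative \<beta> (at x)"
  have J: "open J" and smooth_\<beta>: "smooth_on J \<beta>"
    using base by (simp_all add: cylinder_base_def unit_speed_curve_def open_interval_D)
  obtain d where d: "\<And>x. x \<in> J \<Longrightarrow> V \<bullet> \<beta> x = d"
    using base unfolding cylinder_base_def by blast
  have tJ: "t s \<in> J" if "s \<in> I" for s using on that by (simp add: lies_on_cylinder_def)
  have smooth_t: "smooth_on I t" and smooth_z: "smooth_on I z"
    using on by (simp_all add: lies_on_cylinder_def)
  show "smooth_on I M"
    unfolding M_def cylinder_normal_def
    by (rule smooth_on_cross3[OF open_I smooth_on_compose[OF open_I J smooth_t
            smooth_on_vector_derivative[OF smooth_\<beta>] tJ] smooth_on_const[OF open_I]])
  fix s assume s: "s \<in> I"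
  note \<beta>' = smooth_on_has_vector_derivative[OF smooth_\<beta> tJ[OF s]]
  have "V \<bullet> ?\<beta>' (t s) + 0 \<bullet> \<beta> (t s) = 0"
    using J tJ[OF s] d has_vector_derivative_const \<beta>' by (rule derivative_of_constant_inner)
  moreover have "norm (?\<beta>' (t s)) = 1"
    using base tJ[OF s] by (simp add: cylinder_base_def unit_speed_curve_def)
  ultimately show "norm (M s) = 1"
    using V by (simp add: M_def cylinder_normal_def norm_eq_1 dot_cross inner_commute)
  show "M s \<bullet> V = 0" by (simp add: M_def cylinder_normal_def dot_cross_self)
  obtain t' z' where t': "(t has_vector_derivative t') (at s)"
    and z': "(z has_vector_derivative z') (at s)"
    using smooth_on_has_vector_derivative smooth_t smooth_z s by blast
  have "((\<lambda>s. \<beta> (t s) + z s *\<^sub>R V) has_vector_derivative t' *\<^sub>R ?\<beta>' (t s) + z' *\<^sub>R V) (at s)"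
    using vector_diff_chain_at[OF t' \<beta>']
      bounded_linear.has_vector_derivative[OF bounded_linear_scaleR_left z']
    by (intro has_vector_derivative_add) (simp_all add: o_def)
  then have "(\<alpha> has_vector_derivative t' *\<^sub>R ?\<beta>' (t s) + z' *\<^sub>R V) (at s)"
    using open_I s
    by (rule has_vector_derivative_transform_within_open)
      (use on in \<open>simp add: lies_on_cylinder_def cylinder_param_def\<close>)
  from vector_derivative_unique_at[OF curve_derivative[OF s] this]
  show "M s \<bullet> T s = 0"
    by (simp add: M_def cylinder_normal_def inner_add_right dot_cross_self inner_commute)
qed

text \<open>
  The field \<open>W\<close> is the cylinder normal itself. Its \<open>N\<close>-component is the cosine of the given angle;
  its \<open>B\<close>-component has constant square and cannot change sign by continuity.
\<close>
lemma on_cylinder_imp_normal_helix: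
  assumes V: "norm V = 1"
    and base: "cylinder_base J \<beta> V" and on: "lies_on_cylinder I \<alpha> J \<beta> V t z"
    and angle: "constant_angle I N (\<lambda>s. cylinder_normal \<beta> V (t s) (z s))"
  shows "\<exists>W. normal_helix_field I \<alpha> V W \<and> (\<forall>s\<in>I. W s \<bullet> V = 0)"
proof -
  define M where "M s = cylinder_normal \<beta> V (t s) (z s)" for s
  note M = cylinder_normal_along_curve[OF V base on, folded M_def]
  obtain \<theta> where \<theta>: "\<And>s. s \<in> I \<Longrightarrow> vec_angle (N s) (M s) = \<theta>"
    using angle by (auto simp: constant_angle_def M_def)
  have b: "M s \<bullet> N s = cos \<theta>" if s: "s \<in> I" for s
  proof -
    have n: "norm (N s) = 1" using frame(2)[OF s] by (simp add: norm_eq_1)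
    have "\<bar>M s \<bullet> N s\<bar> \<le> 1"
      using Cauchy_Schwarz_ineq2[of "M s" "N s"] n M(2)[OF s] by simp
    then show ?thesis
      using \<theta>[OF s] vec_angle_unit[OF n M(2)[OF s]] by (auto simp: inner_commute cos_arccos_abs)
  qed
  have M_expansion: "M s = cos \<theta> *\<^sub>R N s + (M s \<bullet> B s) *\<^sub>R B s" if s: "s \<in> I" for s
    using frame_expansion[OF s, of "M s"] M(4)[OF s] b[OF s] by simp
  have square: "(M s \<bullet> B s)\<^sup>2 = 1 - (cos \<theta>)\<^sup>2" if s: "s \<in> I" for s
  proof -
    have "M s \<bullet> M s = (cos \<theta>)\<^sup>2 + (M s \<bullet> B s)\<^sup>2"
      by (subst (2) M_expansion[OF s]) (simp add: inner_add_right b[OF s] power2_eq_square)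
    then show ?thesis using M(2)[OF s] by (simp add: norm_eq_1)
  qed
  have "continuous_on I (\<lambda>s. M s \<bullet> B s)"
    by (intro smooth_on_imp_continuous_on smooth_on_inner open_I M(1) smooth_binormal)
  from continuous_square_constant_imp_constant[OF open_interval_D(3)[OF interval] this square]
  obtain c where c: "\<And>s. s \<in> I \<Longrightarrow> M s \<bullet> B s = c" by auto
  define W where "W s = cos \<theta> *\<^sub>R N s + c *\<^sub>R B s" for s
  have W: "W s = M s" if "s \<in> I" for s
    using M_expansion[OF that] c[OF that] by (simp add: W_def)
  have "F_constant I \<alpha> W"
    unfolding W_def[abs_def] by (rule F_constant_combination)
  moreover have "unit_field I W"
    using M(2) by (simp add: unit_field_def W)
  moreover have "vec_angle (W s) V = arccos 0" if "s \<in> I" for s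
    using M(3)[OF that] by (simp add: vec_angle_def W[OF that])
  then have "constant_angle I W (\<lambda>_. V)"
    unfolding constant_angle_def by blast
  moreover have "normal_field I \<alpha> W"
    unfolding normal_field_def W_def
    by (intro ballI span_add span_scale span_base) auto
  ultimately have "normal_helix_field I \<alpha> V W"
    by (simp add: normal_helix_field_def helix_field_def)
  moreover have "\<forall>s\<in>I. W s \<bullet> V = 0" using M(3) by (simp add: W)
  ultimately show ?thesis by blast
qed

end

theorem theorem2p2:
  fixes I :: "real set" and \<alpha> :: "real \<Rightarrow> real^3" and V :: "real^3"
  assumes "open_interval I"
    and "unit_speed_curve I \<alpha>"
    and "\<forall>s\<in>I. curvature \<alpha> s > 0"
    and "nonplanar I \<alpha>"
    and "norm V = 1"
  shows "(\<exists>W. normal_helix_field I \<alpha> V W \<and> (\<forall>s\<in>I. W s \<bullet> V = 0)) \<longleftrightarrow>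
         (\<exists>J \<beta> t z. cylinder_base J \<beta> V \<and> lies_on_cylinder I \<alpha> J \<beta> V t z \<and>
            constant_angle I (principal_normal \<alpha>) (\<lambda>s. cylinder_normal \<beta> V (t s) (z s)))"
proof -
  interpret frenet_curve I \<alpha>
    using assms(1-3) by unfold_locales simp_all
  show ?thesis
    using normal_helix_imp_on_cylinder[OF assms(4,5)] on_cylinder_imp_normal_helix[OF assms(5)]
    by blast
qed

end
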